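(* Let $\mathcal{M}$ be an interactive mechanism answering linear queries that is $(\varepsilon,\delta,\kappa)$-partial differentially private and $(\alpha,\beta)$-sample accurate. Then for every data distribution $\mathcal{P}$ on $\mathcal{X}$, every adversary $\mathcal{A}$, and all constants $c,d>0$, $$\Pr_{S\sim\mathcal{P}^m,\ \Pi\sim I(\mathcal{M},\mathcal{A};S)}\left[\max_t\left|a_t-q_t(\mathcal{P}^m)\right|>\alpha+(e^\varepsilon-1)+\frac{2\kappa}{m}+c+2d\right]\le\frac{\delta}{d}+\frac{\beta}{c}.$$
   Context: Setting. A dataset $S\in\mathcal{X}^m$ is held by a mechanism $\mathcal{M}$, where $\mathcal{X}$ is countable. An adversary $\mathcal{A}$ interacts with $\mathcal{M}$: at each step $t$ the adversary chooses a query $q_t$ depending on the interaction so far, and $\mathcal{M}$ returns an answer $a_t\in\mathbb{R}$. The transcript of this interaction is a random variable $\Pi$ with values in the space of transcripts $\mathbf{\Pi}$. Its distribution when $\mathcal{M}$ holds $S$ is denoted $I(\mathcal{M},\mathcal{A};S)$. Linear queries. A linear query is $q(S)=\frac1m\sum_{i=1}^m q_i(S_i)$ with each $q_i:\mathcal{X}\to[0,1]$. For a distribution $\mathcal{P}$ on $\mathcal{X}$, write $q(\mathcal{P}^m)=\mathbb{E}_{S\sim\mathcal{P}^m}[q(S)]$. Partial differential privacy. $\mathcal{M}$ is $(\varepsilon,\delta,\kappa)$-partial differentially private if there is a map $f_L:\mathbf{\Pi}\to 2^{[m]}$ with $\max_\pi|f_L(\pi)|\le\kappa$ such that the following holds.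 For every adversary $\mathcal{A}$, every index $i$, every pair $S,S'\in\mathcal{X}^m$ differing only in position $i$, and every event $E\subseteq\mathbf{\Pi}$ with $i\notin\bigcup_{\pi\in E}f_L(\pi)$, $$\Pr_{\Pi\sim I(\mathcal{M},\mathcal{A};S)}[\Pi\in E]\le e^\varepsilon\Pr_{\Pi\sim I(\mathcal{M},\mathcal{A};S')}[\Pi\in E]+\delta.$$ Sample accuracy. $\mathcal{M}$ is $(\alpha,\beta)$-sample accurate if, for the adversary $\mathcal{A}$ and distribution $\mathcal{P}$ under consideration, $$\Pr_{S\sim\mathcal{P}^m,\ \Pi\sim I(\mathcal{M},\mathcal{A};S)}\left[\max_t|a_t-q_t(S)|\ge\alpha\right]\le\beta.$$
   Formalization: Proved for 0 < c ≤ 1 only: with real answers the claim fails for c > 1 (a mechanism always answering a huge constant is (0,0,0)-partially DP and (0,1)-sample accurate; left side 1, right side 1/c). The map f_L is taken measurable. *)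

theory Defs
  imports "HOL-Probability.Probability"
begin

text \<open>
  Datasets of size \<open>m\<close> are functions \<open>'m \<Rightarrow> 'x\<close> on a finite index type with \<open>m = CARD('m)\<close>; the
  data universe \<open>'x\<close> is countable and carries the discrete sigma-algebra.  A query is given by its
  components \<open>q i :: 'x \<Rightarrow> real\<close>.  Interactions have a fixed number \<open>k\<close> of rounds, numbered
  \<open>0, \<dots>, k - 1\<close>, and a transcript of \<open>t\<close> rounds is an (extensional) function on \<open>{..<t}\<close> giving
  the query and the answer of each round.
\<close>

type_synonym ('m, 'x) query = "'m \<Rightarrow> 'x \<Rightarrow> real"
type_synonym ('m, 'x) transcript = "nat \<Rightarrow> ('m, 'x) query \<times> real"

definition query_space :: "('m::finite, 'x::countable) query measure" where
  "query_space = (\<Pi>\<^sub>M i\<in>UNIV. \<Pi>\<^sub>M x\<in>UNIV. restrict_space borel {0..1})"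

definition transcript_space :: "nat \<Rightarrow> ('m::finite, 'x::countable) transcript measure" where
  "transcript_space t = (\<Pi>\<^sub>M s\<in>{..<t}. query_space \<Otimes>\<^sub>M borel)"

definition query_value :: "('m::finite, 'x::countable) query \<Rightarrow> ('m \<Rightarrow> 'x) \<Rightarrow> real" where
  "query_value q S = (\<Sum>i\<in>UNIV. q i (S i)) / real CARD('m)"

definition iid_sample :: "'x::countable pmf \<Rightarrow> ('m::finite \<Rightarrow> 'x) pmf" where
  "iid_sample P = Pi_pmf UNIV undefined (\<lambda>_. P)"

definition population_value :: "('m::finite, 'x::countable) query \<Rightarrow> 'x pmf \<Rightarrow> real" where
  "population_value q P = measure_pmf.expectation (iid_sample P) (query_value q)"


text \<open>
  Both parties are randomized; answers are arbitrary reals.  An adversary is a family of probability kernels: \<open>A t h\<close> is the law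
  of the query in round \<open>t\<close> given the transcript \<open>h\<close> of the rounds before.  For a mechanism,
  \<open>M S t h q\<close> is the law of the answer in round \<open>t\<close> to the query \<open>q\<close>, given the dataset \<open>S\<close> and
  the transcript \<open>h\<close> of the rounds before.
\<close>

type_synonym ('m, 'x) adversary =
  "nat \<Rightarrow> ('m, 'x) transcript \<Rightarrow> ('m, 'x) query measure"
type_synonym ('m, 'x) mechanism =
  "('m \<Rightarrow> 'x) \<Rightarrow> nat \<Rightarrow> ('m, 'x) transcript \<Rightarrow> ('m, 'x) query \<Rightarrow> real measure"

definition adversary :: "nat \<Rightarrow> ('m::finite, 'x::countable) adversary \<Rightarrow> bool" where
  "adversary k A \<longleftrightarrow> (\<forall>t<k. A t \<in> transcript_space t \<rightarrow>\<^sub>M prob_algebra query_space)"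

definition mechanism :: "nat \<Rightarrow> ('m::finite, 'x::countable) mechanism \<Rightarrow> bool" where
  "mechanism k M \<longleftrightarrow>
     (\<forall>S. \<forall>t<k. (\<lambda>(h, q). M S t h q) \<in> transcript_space t \<Otimes>\<^sub>M query_space \<rightarrow>\<^sub>M prob_algebra borel)"

primrec interaction ::
  "('m::finite, 'x::countable) mechanism \<Rightarrow> ('m, 'x) adversary \<Rightarrow> ('m \<Rightarrow> 'x) \<Rightarrow> nat \<Rightarrow>
     ('m, 'x) transcript measure" where
  "interaction M A S 0 = return (transcript_space 0) (\<lambda>_. undefined)"
| "interaction M A S (Suc t) =
     interaction M A S t \<bind> (\<lambda>h. A t h \<bind> (\<lambda>q.
       distr (M S t h q) (transcript_space (Suc t)) (\<lambda>a. h(t := (q, a)))))"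

text \<open>The joint law of the random dataset and the transcript it gives rise to.\<close>

definition sample_interaction ::
  "nat \<Rightarrow> ('m::finite, 'x::countable) mechanism \<Rightarrow> ('m, 'x) adversary \<Rightarrow> 'x pmf \<Rightarrow>
     (('m \<Rightarrow> 'x) \<times> ('m, 'x) transcript) measure" where
  "sample_interaction k M A P =
     measure_pmf (iid_sample P) \<bind> (\<lambda>S.
       distr (interaction M A S k) (count_space UNIV \<Otimes>\<^sub>M transcript_space k) (Pair S))"


text \<open>
  The map \<open>f\<^sub>L\<close> has to be measurable: if \<open>f\<^sub>L\<close> partitioned the transcripts into sets of full outer
  measure, then no event of positive probability would avoid an index, and the condition would
  hold for every mechanism already with \<open>\<kappa> = 1\<close>.
\<close>

definition partial_dp ::
  "nat \<Rightarrow> ('m::finite, 'x::countable) mechanism \<Rightarrow> real \<Rightarrow> real \<Rightarrow> nat \<Rightarrow> bool" where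
  "partial_dp k M \<epsilon> \<delta> \<kappa> \<longleftrightarrow>
     (\<exists>f\<^sub>L :: ('m, 'x) transcript \<Rightarrow> 'm set.
        f\<^sub>L \<in> transcript_space k \<rightarrow>\<^sub>M count_space UNIV \<and>
        (\<forall>\<pi>\<in>space (transcript_space k). card (f\<^sub>L \<pi>) \<le> \<kappa>) \<and>
        (\<forall>A i S S' E.
           adversary k A \<longrightarrow>
           (\<forall>j. j \<noteq> i \<longrightarrow> S j = S' j) \<longrightarrow>
           E \<in> sets (transcript_space k) \<longrightarrow>
           i \<notin> (\<Union>\<pi>\<in>E. f\<^sub>L \<pi>) \<longrightarrow>
           measure (interaction M A S k) E \<le> exp \<epsilon> * measure (interaction M A S' k) E + \<delta>))"

definition sample_error ::
  "nat \<Rightarrow> ('m::finite, 'x::countable) transcript \<Rightarrow> ('m \<Rightarrow> 'x) \<Rightarrow> real" where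
  "sample_error k \<pi> S = Max ((\<lambda>t. \<bar>snd (\<pi> t) - query_value (fst (\<pi> t)) S\<bar>) ` {..<k})"

definition population_error ::
  "nat \<Rightarrow> ('m::finite, 'x::countable) transcript \<Rightarrow> 'x pmf \<Rightarrow> real" where
  "population_error k \<pi> P = Max ((\<lambda>t. \<bar>snd (\<pi> t) - population_value (fst (\<pi> t)) P\<bar>) ` {..<k})"

definition sample_accurate ::
  "nat \<Rightarrow> ('m::finite, 'x::countable) mechanism \<Rightarrow> ('m, 'x) adversary \<Rightarrow> 'x pmf \<Rightarrow>
     real \<Rightarrow> real \<Rightarrow> bool" where
  "sample_accurate k M A P \<alpha> \<beta> \<longleftrightarrow>
     measure (sample_interaction k M A P)
       {(S, \<pi>) \<in> space (sample_interaction k M A P). sample_error k \<pi> S \<ge> \<alpha>} \<le> \<beta>"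

end

theory Submission
  imports Defs
begin

text \<open>
  The argument avoids posterior distributions.  Up to the levels of a layer-cake integral, privacy
  together with the exchange of \<open>S i\<close> for a fresh sample bounds the expectation of
  \<open>h (S i) \<Pi>\<close> by \<open>exp \<epsilon>\<close> times that of \<open>\<Sum>x. P x * h x \<Pi>\<close>, plus \<open>\<delta>\<close>, for every \<open>[0, 1]\<close>-valued \<open>h\<close>
  vanishing where \<open>i \<in> f\<^sub>L \<Pi>\<close>.  Averaging over \<open>i\<close>, a query selected from the transcript exceeds its
  population value on an event \<open>B\<close> by at most \<open>(exp \<epsilon> - 1 + \<kappa> / m) * Pr B + \<delta>\<close> in expectation
  (with \<open>exp \<epsilon> - 1\<close> replaced by \<open>0\<close> if it is negative).

  Now let \<open>B\<close> be the event of a large population error, and select the first query answered badly,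
  complemented if necessary.  Let \<open>p\<close> be its population value and \<open>gap\<close> the population error bound
  minus \<open>\<alpha>\<close>.  Where the sample error is below \<open>\<alpha>\<close>, the sample value exceeds \<open>p\<close> by more than
  \<open>gap\<close>.  This is impossible if \<open>p + gap > 1\<close>, so that part of \<open>B\<close> costs only sample
  error.  On the rest, the excess is at least \<open>gap - 1\<close> even where the sample error is large, and
  comparing expectations gives, unless \<open>d \<le> \<delta>\<close> makes the claim trivial,
  \<open>(c + d) * Pr B \<le> \<delta> + Pr (B and large sample error)\<close>.
\<close>

section \<open>Layer-cake integration\<close>

text \<open>Fubini for the region below the graph of \<open>h\<close>; values in the unit interval
  restrict the levels to \<open>{0..1}\<close>.\<close>

lemma nn_integral_layer_cake:
  fixes h :: "'a \<Rightarrow> real"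
  assumes "sigma_finite_measure M" and [measurable]: "h \<in> borel_measurable M"
    and h: "\<And>x. x \<in> space M \<Longrightarrow> h x \<in> {0..1}"
  shows "(\<integral>\<^sup>+x. ennreal (h x) \<partial>M) =
    (\<integral>\<^sup>+t. indicator {0..1} t * emeasure M {x \<in> space M. t < h x} \<partial>lborel)"
proof -
  interpret sigma_finite_measure M by fact
  interpret pair_sigma_finite lborel M ..
  have "(\<integral>\<^sup>+t. indicator {0..1} t * emeasure M {x \<in> space M. t < h x} \<partial>lborel) =
      (\<integral>\<^sup>+t. \<integral>\<^sup>+x. indicator {0..1::real} t * indicator {x \<in> space M. t < h x} x \<partial>M \<partial>lborel)"
    by (simp add: nn_integral_cmult)
  also have "\<dots> = (\<integral>\<^sup>+t. \<integral>\<^sup>+x. indicator {0..1::real} t * (if t < h x then 1 else 0) \<partial>M \<partial>lborel)"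
    by (intro nn_integral_cong) (auto split: split_indicator)
  also have "\<dots> = (\<integral>\<^sup>+x. \<integral>\<^sup>+t. indicator {0..1::real} t * (if t < h x then 1 else 0) \<partial>lborel \<partial>M)"
    by (rule Fubini'[symmetric]) measurable
  \<comment> \<open>Since \<open>h x \<le> 1\<close>, the levels \<open>t\<close> in
    \<open>{0..1}\<close> with \<open>t < h x\<close> form the half-open interval
    \<open>{0..<h x}\<close>, whose length is \<open>h x\<close>.\<close>
  also have "\<dots> = (\<integral>\<^sup>+x. \<integral>\<^sup>+t. indicator {0..<h x} t \<partial>lborel \<partial>M)"
    using h by (intro nn_integral_cong) (fastforce split: split_indicator)
  also have "\<dots> = (\<integral>\<^sup>+x. ennreal (h x) \<partial>M)"
    using h by (intro nn_integral_cong) auto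
  finally show ?thesis by simp
qed

text \<open>The levels fill an interval of length 1, so integrating the bound over them leaves the
  additive term \<open>d\<close> unscaled. This is how privacy, a statement about events, becomes
  one about expectations.\<close>

lemma nn_integral_le_if_emeasure_level_le:
  fixes h :: "'a \<Rightarrow> real" and c d :: ennreal
  assumes M: "sigma_finite_measure M" "sets M = sets L" and N: "sigma_finite_measure N" "sets N = sets L"
    and h[measurable]: "h \<in> borel_measurable L" "\<And>x. x \<in> space L \<Longrightarrow> h x \<in> {0..1}"
    and le: "\<And>t. 0 \<le> t \<Longrightarrow>
      emeasure M {x \<in> space L. t < h x} \<le> c * emeasure N {x \<in> space L. t < h x} + d"
  shows "(\<integral>\<^sup>+x. ennreal (h x) \<partial>M) \<le> c * (\<integral>\<^sup>+x. ennreal (h x) \<partial>N) + d"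
proof -
  have sp: "space M = space L" "space N = space L"
    using M N by (auto dest: sets_eq_imp_space_eq)
  note [measurable_cong] = M(2) N(2)
  interpret N: sigma_finite_measure N by fact
  have meas: "(\<lambda>t. emeasure N {x \<in> space L. t < h x}) \<in> borel_measurable lborel"
    unfolding sp(2)[symmetric] by measurable
  have "(\<integral>\<^sup>+x. ennreal (h x) \<partial>M) =
      (\<integral>\<^sup>+t. indicator {0..1} t * emeasure M {x \<in> space L. t < h x} \<partial>lborel)"
    using nn_integral_layer_cake[OF M(1), of h] h sp by simp
  also have "\<dots> \<le> (\<integral>\<^sup>+t. c * (indicator {0..1} t * emeasure N {x \<in> space L. t < h x}) +
      d * indicator {0..1} t \<partial>lborel)"
    using le by (intro nn_integral_mono) (auto split: split_indicator)
  also have "\<dots> = c * (\<integral>\<^sup>+t. indicator {0..1} t * emeasure N {x \<in> space L. t < h x} \<partial>lborel) + d"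
    using meas by (subst nn_integral_add) (auto simp: nn_integral_cmult)
  also have "(\<integral>\<^sup>+t. indicator {0..1} t * emeasure N {x \<in> space L. t < h x} \<partial>lborel) =
      (\<integral>\<^sup>+x. ennreal (h x) \<partial>N)"
    using nn_integral_layer_cake[OF N(1), of h] h sp by simp
  finally show ?thesis .
qed

section \<open>Exchange of one sample point\<close>

text \<open>The map is an involution that exchanges two of the \<open>m + 1\<close> independent
  coordinates, all of law \<open>P\<close>, so the product weight of every point is
  preserved.\<close>

lemma iid_sample_swap:
  "map_pmf (\<lambda>(S, y). (S(i := y), S i)) (pair_pmf (iid_sample P) P) = pair_pmf (iid_sample P) P"
proof (rule pmf_eqI)
  fix z :: "('a \<Rightarrow> 'b) \<times> 'b"
  obtain S y where z: "z = (S, y)" by fastforce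
  let ?f = "\<lambda>(S :: 'a \<Rightarrow> 'b, y). (S(i := y), S i)"
  have inv: "?f (?f w) = w" for w :: "('a \<Rightarrow> 'b) \<times> 'b"
    by (cases w) auto
  have inj: "inj ?f"
    by (rule inj_on_inverseI[where g="?f"]) (rule inv)
  \<comment> \<open>Writing \<open>z\<close> as \<open>?f (?f z)\<close> presents it as an image
    point, where the pmf of an injective image is known.\<close>
  have "pmf (map_pmf ?f (pair_pmf (iid_sample P) P)) (?f (?f z)) =
      pmf (pair_pmf (iid_sample P) P) (?f z)"
    by (rule pmf_map_inj') (rule inj)
  also have "\<dots> = pmf (pair_pmf (iid_sample P) P) z"
  proof -
    \<comment> \<open>Only the factor at \<open>i\<close> is affected: it trades places with the
      weight of the extra point \<open>y\<close>.\<close>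
    have split: "(\<Prod>j\<in>UNIV. pmf P (T j)) = pmf P (T i) * (\<Prod>j\<in>UNIV - {i}. pmf P (T j))" for T :: "'a \<Rightarrow> 'b"
      by (rule prod.remove) auto
    have "(\<Prod>j\<in>UNIV - {i}. pmf P ((S(i := y)) j)) = (\<Prod>j\<in>UNIV - {i}. pmf P (S j))"
      by (rule prod.cong) auto
    then show ?thesis
      unfolding z iid_sample_def
      by (simp add: pmf_pair pmf_Pi split[of S] split[of "S(i := y)"] fun_upd_same del: fun_upd_apply)
  qed
  finally show "pmf (map_pmf ?f (pair_pmf (iid_sample P) P)) z = pmf (pair_pmf (iid_sample P) P) z"
    using inv[of z] by simp
qed

section \<open>Queries, transcripts and the law of the interaction\<close>

lemma measurable_pair_measure_pmf:
  fixes p :: "'b::countable pmf"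
  assumes [measurable]: "\<And>x. f x \<in> N \<rightarrow>\<^sub>M K"
  shows "(\<lambda>(y, x). f x y) \<in> N \<Otimes>\<^sub>M measure_pmf p \<rightarrow>\<^sub>M K"
  unfolding case_prod_beta
  by (rule measurable_compose_countable'[where I=UNIV and f="\<lambda>x z. f x (fst z)" and g=snd]) auto

lemma measurable_query_component [measurable]:
  "(\<lambda>q. q i x) \<in> borel_measurable query_space"
proof -
  have "(\<lambda>q. q i x) \<in> query_space \<rightarrow>\<^sub>M restrict_space borel {0..1::real}"
    unfolding query_space_def
    by (rule measurable_compose[where f="\<lambda>q. q i" and g="\<lambda>r. r x" and N="\<Pi>\<^sub>M x\<in>UNIV. restrict_space borel {0..1}"])
       measurable
  then show ?thesis
    by (simp add: measurable_restrict_space2_iff)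
qed

lemma query_space_bounds:
  assumes "q \<in> space query_space"
  shows "q i x \<in> {0..1}"
  using assms by (auto simp: query_space_def space_PiM PiE_iff space_restrict_space)

lemma measurable_transcript_component [measurable (raw)]:
  "t < k \<Longrightarrow> (\<lambda>\<pi>. \<pi> t) \<in> transcript_space k \<rightarrow>\<^sub>M query_space \<Otimes>\<^sub>M borel"
  unfolding transcript_space_def by measurable

lemma bind_in_prob_algebra:
  "p \<in> space (prob_algebra N) \<Longrightarrow> K \<in> N \<rightarrow>\<^sub>M prob_algebra R \<Longrightarrow> p \<bind> K \<in> space (prob_algebra R)"
  using measurable_space[OF measurable_bind_prob_space[OF measurable_const[of p _ "count_space UNIV"]]]
  by simp

lemma distr_in_prob_algebra:
  "p \<in> space (prob_algebra N) \<Longrightarrow> f \<in> N \<rightarrow>\<^sub>M R \<Longrightarrow> distr p R f \<in> space (prob_algebra R)"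
  using measurable_space[OF measurable_distr_prob_space] .

text \<open>Induction over the rounds: drawing a query, drawing an answer and appending both is a
  probability kernel from histories of length \<open>t\<close> to histories of length
  \<open>Suc t\<close>.\<close>

lemma interaction_in_prob_algebra:
  assumes M: "mechanism k M" and A: "adversary k A" and "t \<le> k"
  shows "interaction M A S t \<in> space (prob_algebra (transcript_space t))"
  using \<open>t \<le> k\<close>
proof (induction t)
  case 0
  show ?case
    by (auto simp: space_prob_algebra transcript_space_def space_PiM intro!: prob_space_return)
next
  case (Suc t)
  have [measurable]: "A t \<in> transcript_space t \<rightarrow>\<^sub>M prob_algebra query_space"
    using A Suc by (auto simp: adversary_def)
  have M': "(\<lambda>(h, q). M S t h q) \<in> transcript_space t \<Otimes>\<^sub>M query_space \<rightarrow>\<^sub>M prob_algebra borel"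
    using M Suc by (auto simp: mechanism_def)
  have upd: "(\<lambda>(p, a). (fst p)(t := (snd p, a))) \<in>
      (transcript_space t \<Otimes>\<^sub>M query_space) \<Otimes>\<^sub>M borel \<rightarrow>\<^sub>M transcript_space (Suc t)"
    unfolding transcript_space_def case_prod_beta
    by (rule measurable_fun_upd[where J="{..<t}"]) (auto simp: lessThan_Suc)
  have "(\<lambda>h. A t h \<bind> (\<lambda>q. distr (M S t h q) (transcript_space (Suc t)) (\<lambda>a. h(t := (q, a)))))
      \<in> transcript_space t \<rightarrow>\<^sub>M prob_algebra (transcript_space (Suc t))"
    using measurable_distr_prob_space2[OF M' , of "\<lambda>p a. (fst p)(t := (snd p, a))" "transcript_space (Suc t)"] upd
    by (intro measurable_bind_prob_space2[where N=query_space]) (auto simp: case_prod_beta')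
  moreover have "interaction M A S t \<in> space (prob_algebra (transcript_space t))"
    using Suc by simp
  ultimately show ?case
    by (simp add: bind_in_prob_algebra)
qed

text \<open>Datasets carry the discrete sigma-algebra, so it suffices that each fixed
  \<open>S\<close> yields a probability law.\<close>

lemma sample_interaction_kernel:
  assumes "mechanism k M" and "adversary k A"
  shows "(\<lambda>S. distr (interaction M A S k) (count_space UNIV \<Otimes>\<^sub>M transcript_space k) (Pair S))
    \<in> measure_pmf p \<rightarrow>\<^sub>M prob_algebra (count_space UNIV \<Otimes>\<^sub>M transcript_space k)"
proof -
  have "(\<lambda>S. distr (interaction M A S k) (count_space UNIV \<Otimes>\<^sub>M transcript_space k) (Pair S))
    \<in> count_space UNIV \<rightarrow>\<^sub>M prob_algebra (count_space UNIV \<Otimes>\<^sub>M transcript_space k)"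
    by (auto intro!: distr_in_prob_algebra[OF interaction_in_prob_algebra[OF assms order_refl]])
  then show ?thesis by simp
qed

lemma prob_space_sample_interaction:
  assumes "mechanism k M" and "adversary k A"
  shows "prob_space (sample_interaction k M A P)"
    and "sets (sample_interaction k M A P) = sets (count_space UNIV \<Otimes>\<^sub>M transcript_space k)"
proof -
  have "sample_interaction k M A P \<in> space (prob_algebra (count_space UNIV \<Otimes>\<^sub>M transcript_space k))"
    unfolding sample_interaction_def
    by (rule bind_in_prob_algebra[OF _ sample_interaction_kernel[OF assms]])
       (simp add: space_prob_algebra measure_pmf.prob_space_axioms)
  then show "prob_space (sample_interaction k M A P)"
    and "sets (sample_interaction k M A P) = sets (count_space UNIV \<Otimes>\<^sub>M transcript_space k)"
    by (auto simp: space_prob_algebra)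
qed

lemma nn_integral_sample_interaction:
  assumes "mechanism k M" and "adversary k A"
    and [measurable]: "f \<in> borel_measurable (count_space UNIV \<Otimes>\<^sub>M transcript_space k)"
  shows "(\<integral>\<^sup>+z. f z \<partial>sample_interaction k M A P) =
    (\<integral>\<^sup>+S. \<integral>\<^sup>+\<pi>. f (S, \<pi>) \<partial>interaction M A S k \<partial>measure_pmf (iid_sample P))"
proof -
  have [measurable_cong]: "sets (interaction M A S k) = sets (transcript_space k)" for S
    using interaction_in_prob_algebra[OF assms(1,2) order_refl] by (auto simp: space_prob_algebra)
  show ?thesis
    unfolding sample_interaction_def
    by (subst nn_integral_bind[OF assms(3) measurable_prob_algebraD[OF sample_interaction_kernel[OF assms(1,2)]]])
       (simp add: nn_integral_distr)
qed

section \<open>Partial privacy in expectation\<close>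

text \<open>The function \<open>h\<close> may look at \<open>S i\<close> itself, whereas privacy
  concerns events of transcripts. Fixing the first argument of \<open>h\<close> before changing the
  dataset separates the two roles of \<open>S i\<close>.\<close>

lemma partial_dp_transfer:
  fixes M :: "('m::finite, 'x::countable) mechanism"
  assumes M: "mechanism k M" and A: "adversary k A"
    and f: "f\<^sub>L \<in> transcript_space k \<rightarrow>\<^sub>M count_space UNIV"
    and dp: "\<And>i S S' E. (\<forall>j. j \<noteq> i \<longrightarrow> S j = S' j) \<Longrightarrow> E \<in> sets (transcript_space k) \<Longrightarrow>
           i \<notin> (\<Union>\<pi>\<in>E. f\<^sub>L \<pi>) \<Longrightarrow>
           measure (interaction M A S k) E \<le> exp \<epsilon> * measure (interaction M A S' k) E + \<delta>"
    and h[measurable]: "\<And>x. h x \<in> borel_measurable (transcript_space k)"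
    and h01: "\<And>x \<pi>. \<pi> \<in> space (transcript_space k) \<Longrightarrow> h x \<pi> \<in> {0..1}"
    and h0: "\<And>x \<pi>. \<pi> \<in> space (transcript_space k) \<Longrightarrow> i \<in> f\<^sub>L \<pi> \<Longrightarrow> h x \<pi> = 0"
  shows "(\<integral>z. h (fst z i) (snd z) \<partial>sample_interaction k M A P) \<le>
    exp \<epsilon> * (\<integral>z. (\<integral>x. h x (snd z) \<partial>P) \<partial>sample_interaction k M A P) + \<delta>"
proof -
  let ?I = "\<lambda>S. interaction M A S k" and ?L = "transcript_space k :: ('m, 'x) transcript measure"
  let ?J = "sample_interaction k M A P"
  have \<delta>: "0 \<le> \<delta>"
    using dp[of _ _ _ "{}"] by auto
  have prob: "prob_space (?I S)" and sets: "sets (?I S) = sets ?L" for S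
    using interaction_in_prob_algebra[OF M A order_refl] by (auto simp: space_prob_algebra)
  have spJ: "space ?J = UNIV \<times> space ?L"
    using prob_space_sample_interaction(2)[OF M A, of P, THEN sets_eq_imp_space_eq] by (simp add: space_pair_measure)
  note setsJ = prob_space_sample_interaction(2)[OF M A]
  note [measurable_cong] = sets
  interpret J: prob_space ?J by (rule prob_space_sample_interaction[OF M A])
  \<comment> \<open>Here \<open>x\<close> is unrelated to \<open>S\<close> and \<open>S'\<close>, so
    that it can later be set to the old entry \<open>S i\<close>.\<close>
  have mono: "(\<integral>\<^sup>+\<pi>. h x \<pi> \<partial>?I S) \<le> ennreal (exp \<epsilon>) * (\<integral>\<^sup>+\<pi>. h x \<pi> \<partial>?I S') + ennreal \<delta>"
    if eq: "\<forall>j. j \<noteq> i \<longrightarrow> S j = S' j" for x S S'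
  proof (rule nn_integral_le_if_emeasure_level_le[where L="?L"])
    fix t :: real assume t: "0 \<le> t"
    let ?E = "{\<pi> \<in> space ?L. t < h x \<pi>}"
    interpret S: prob_space "?I S" by (rule prob)
    interpret S': prob_space "?I S'" by (rule prob)
    have "?E \<in> sets ?L" by measurable
    \<comment> \<open>Where \<open>i\<close> lies in \<open>f\<^sub>L \<pi>\<close>,
      \<open>h x \<pi> = 0 \<le> t\<close>; hence no level set with \<open>t \<ge> 0\<close>
      contains such a transcript.\<close>
    moreover have "i \<notin> (\<Union>\<pi>\<in>?E. f\<^sub>L \<pi>)"
      using h0[of _ x] t by fastforce
    ultimately have "measure (?I S) ?E \<le> exp \<epsilon> * measure (?I S') ?E + \<delta>"
      by (rule dp[OF eq])
    then show "emeasure (?I S) ?E \<le> ennreal (exp \<epsilon>) * emeasure (?I S') ?E + ennreal \<delta>"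
      using \<delta> by (simp add: S.emeasure_eq_measure S'.emeasure_eq_measure flip: ennreal_mult ennreal_plus)
  qed (use prob sets h01 in \<open>auto intro: prob_space_imp_sigma_finite\<close>)
  have m1: "(\<lambda>z. h (fst z i) (snd z)) \<in> borel_measurable (count_space UNIV \<Otimes>\<^sub>M ?L)"
    by (rule measurable_pair_measure_countable1) auto
  have m3: "(\<lambda>(\<pi>, x). h x \<pi>) \<in> borel_measurable (?L \<Otimes>\<^sub>M measure_pmf P)"
    by (rule measurable_pair_measure_pmf) (rule h)
  have "(\<lambda>\<pi>. \<integral>x. h x \<pi> \<partial>P) \<in> borel_measurable ?L"
    using m3 by (rule measure_pmf.borel_measurable_lebesgue_integral)
  then have m2: "(\<lambda>z. \<integral>x. h x (snd z) \<partial>P) \<in> borel_measurable (count_space UNIV \<Otimes>\<^sub>M ?L)"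
    by (rule measurable_compose[OF measurable_snd])
  have int1: "integrable ?J (\<lambda>z. h (fst z i) (snd z))"
    using h01 m1 by (intro J.integrable_const_bound[where B=1]) (auto intro!: AE_I2 simp: spJ measurable_cong_sets[OF setsJ refl])
  have b2: "(\<integral>x. h x \<pi> \<partial>P) \<in> {0..1}" if "\<pi> \<in> space ?L" for \<pi>
    using h01[OF that]
    by (auto intro!: integral_nonneg measure_pmf.integral_le_const measure_pmf.integrable_const_bound[where B=1])
  have int2: "integrable ?J (\<lambda>z. \<integral>x. h x (snd z) \<partial>P)"
    using b2 m2 by (intro J.integrable_const_bound[where B=1]) (auto intro!: AE_I2 simp: spJ measurable_cong_sets[OF setsJ refl])
  let ?D = "iid_sample P :: ('m \<Rightarrow> 'x) pmf"
  have "(\<integral>\<^sup>+z. h (fst z i) (snd z) \<partial>?J) = (\<integral>\<^sup>+S. \<integral>\<^sup>+\<pi>. h (S i) \<pi> \<partial>?I S \<partial>?D)"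
    using m1 by (subst nn_integral_sample_interaction[OF M A]) auto
  \<comment> \<open>A fresh point \<open>y\<close> is introduced as a dummy variable; it then
    replaces entry \<open>i\<close> of the dataset at the price of privacy.\<close>
  also have "\<dots> = (\<integral>\<^sup>+S. \<integral>\<^sup>+y. \<integral>\<^sup>+\<pi>. h (S i) \<pi> \<partial>?I S \<partial>P \<partial>?D)"
    by simp
  also have "\<dots> \<le> (\<integral>\<^sup>+S. \<integral>\<^sup>+y. ennreal (exp \<epsilon>) * (\<integral>\<^sup>+\<pi>. h (S i) \<pi> \<partial>?I (S(i := y))) + ennreal \<delta> \<partial>P \<partial>?D)"
    by (intro nn_integral_mono mono) auto
  also have "\<dots> = ennreal (exp \<epsilon>) * (\<integral>\<^sup>+S. \<integral>\<^sup>+y. \<integral>\<^sup>+\<pi>. h (S i) \<pi> \<partial>?I (S(i := y)) \<partial>P \<partial>?D) + ennreal \<delta>"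
    by (simp add: nn_integral_add nn_integral_cmult)
  \<comment> \<open>The dataset \<open>S(i := y)\<close> and the displaced entry \<open>S i\<close>
    are jointly distributed like \<open>S\<close> and \<open>y\<close>. After renaming, the point at
    which \<open>h\<close> is evaluated is independent of the dataset driving the
    interaction.\<close>
  also have "(\<integral>\<^sup>+S. \<integral>\<^sup>+y. \<integral>\<^sup>+\<pi>. h (S i) \<pi> \<partial>?I (S(i := y)) \<partial>P \<partial>?D) =
      (\<integral>\<^sup>+w. \<integral>\<^sup>+\<pi>. h (snd w) \<pi> \<partial>?I (fst w) \<partial>map_pmf (\<lambda>(S, y). (S(i := y), S i)) (pair_pmf ?D P))"
    by (simp add: nn_integral_pair_pmf' case_prod_beta)
  also have "\<dots> = (\<integral>\<^sup>+S. \<integral>\<^sup>+y. \<integral>\<^sup>+\<pi>. h y \<pi> \<partial>?I S \<partial>P \<partial>?D)"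
    unfolding iid_sample_swap by (simp add: nn_integral_pair_pmf')
  also have "\<dots> = (\<integral>\<^sup>+S. \<integral>\<^sup>+\<pi>. \<integral>\<^sup>+y. h y \<pi> \<partial>P \<partial>?I S \<partial>?D)"
  proof (rule nn_integral_cong)
    fix S
    interpret S: prob_space "?I S" by (rule prob)
    interpret pair_sigma_finite "?I S" P ..
    show "(\<integral>\<^sup>+y. \<integral>\<^sup>+\<pi>. h y \<pi> \<partial>?I S \<partial>P) = (\<integral>\<^sup>+\<pi>. \<integral>\<^sup>+y. h y \<pi> \<partial>P \<partial>?I S)"
      by (rule Fubini') (use m3 in measurable)
  qed
  also have "\<dots> = (\<integral>\<^sup>+S. \<integral>\<^sup>+\<pi>. ennreal (\<integral>y. h y \<pi> \<partial>P) \<partial>?I S \<partial>?D)"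
  proof (intro nn_integral_cong nn_integral_eq_integral AE_I2)
    fix S \<pi> x assume "\<pi> \<in> space (?I S)"
    then have "h x \<pi> \<in> {0..1}" for x
      using h01 sets[of S, THEN sets_eq_imp_space_eq] by auto
    then show "integrable P (\<lambda>y. h y \<pi>)" "0 \<le> h x \<pi>"
      by (auto intro!: measure_pmf.integrable_const_bound[where B=1])
  qed
  also have "\<dots> = (\<integral>\<^sup>+z. ennreal (\<integral>x. h x (snd z) \<partial>P) \<partial>?J)"
    by (subst nn_integral_sample_interaction[OF M A measurable_compose[OF m2 measurable_ennreal]]) simp
  finally have le: "(\<integral>\<^sup>+z. h (fst z i) (snd z) \<partial>?J) \<le>
      ennreal (exp \<epsilon>) * (\<integral>\<^sup>+z. ennreal (\<integral>x. h x (snd z) \<partial>P) \<partial>?J) + ennreal \<delta>" .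
  have eq1: "(\<integral>\<^sup>+z. h (fst z i) (snd z) \<partial>?J) = ennreal (\<integral>z. h (fst z i) (snd z) \<partial>?J)"
    using h01 by (intro nn_integral_eq_integral int1 AE_I2) (auto simp: spJ)
  have eq2: "(\<integral>\<^sup>+z. ennreal (\<integral>x. h x (snd z) \<partial>P) \<partial>?J) = ennreal (\<integral>z. (\<integral>x. h x (snd z) \<partial>P) \<partial>?J)"
    using b2 by (intro nn_integral_eq_integral int2 AE_I2) (auto simp: spJ)
  have "0 \<le> (\<integral>z. (\<integral>x. h x (snd z) \<partial>P) \<partial>?J)"
    by (rule Bochner_Integration.integral_nonneg) (use b2 in \<open>auto simp: spJ\<close>)
  with le \<delta> show ?thesis
    unfolding eq1 eq2 by (simp flip: ennreal_mult ennreal_plus)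
qed

text \<open>\<open>g i\<close> is component \<open>i\<close> of a query chosen by looking at the
  transcript. Indices outside \<open>f\<^sub>L \<pi>\<close> are handled by
  \<open>partial_dp_transfer\<close>; each of the at most \<open>\<kappa>\<close> others costs at
  most 1 in the sum, hence \<open>\<kappa> / m\<close> in the average.\<close>

lemma partial_dp_selected_gap:
  fixes M :: "('m::finite, 'x::countable) mechanism" and P :: "'x pmf" and g :: "'m \<Rightarrow> 'x \<Rightarrow> ('m, 'x) transcript \<Rightarrow> real"
  assumes M: "mechanism k M" and A: "adversary k A" and dp: "partial_dp k M \<epsilon> \<delta> \<kappa>"
    and g[measurable]: "\<And>i x. g i x \<in> borel_measurable (transcript_space k)"
    and g01: "\<And>i x \<pi>. \<pi> \<in> space (transcript_space k) \<Longrightarrow> g i x \<pi> \<in> {0..1}"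
    and B[measurable]: "B \<in> sets (transcript_space k)"
  defines "J \<equiv> sample_interaction k M A P"
  shows "integrable J (\<lambda>z. indicator B (snd z) * ((\<Sum>i\<in>UNIV. g i (fst z i) (snd z)) / CARD('m)
      - (\<Sum>i\<in>UNIV. \<integral>x. g i x (snd z) \<partial>P) / CARD('m)))" (is ?integrable)
    and "(\<integral>z. indicator B (snd z) *
      ((\<Sum>i\<in>UNIV. g i (fst z i) (snd z)) / CARD('m) - (\<Sum>i\<in>UNIV. \<integral>x. g i x (snd z) \<partial>P) / CARD('m)) \<partial>J)
    \<le> (max (exp \<epsilon> - 1) 0 + real \<kappa> / CARD('m)) * measure J {z \<in> space J. snd z \<in> B} + \<delta>" (is ?gap)
proof -
  let ?L = "transcript_space k :: ('m, 'x) transcript measure"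
  obtain f\<^sub>L where f[measurable]: "f\<^sub>L \<in> ?L \<rightarrow>\<^sub>M count_space UNIV"
    and card: "\<And>\<pi>. \<pi> \<in> space ?L \<Longrightarrow> card (f\<^sub>L \<pi>) \<le> \<kappa>"
    and dp': "\<And>i S S' E. (\<forall>j. j \<noteq> i \<longrightarrow> S j = S' j) \<Longrightarrow> E \<in> sets ?L \<Longrightarrow> i \<notin> (\<Union>\<pi>\<in>E. f\<^sub>L \<pi>) \<Longrightarrow>
           measure (interaction M A S k) E \<le> exp \<epsilon> * measure (interaction M A S' k) E + \<delta>"
    using dp A unfolding partial_dp_def by metis
  interpret J: prob_space J
    unfolding J_def by (rule prob_space_sample_interaction[OF M A])
  have setsJ: "sets J = sets (count_space UNIV \<Otimes>\<^sub>M ?L)"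
    unfolding J_def by (rule prob_space_sample_interaction[OF M A])
  note spJ = sets_eq_imp_space_eq[OF setsJ, unfolded space_pair_measure, simplified]
  have intJ: "integrable J F"
    if "F \<in> borel_measurable (count_space UNIV \<Otimes>\<^sub>M ?L)" and "\<And>z. snd z \<in> space ?L \<Longrightarrow> \<bar>F z\<bar> \<le> 1"
    for F :: "_ \<Rightarrow> real"
    using that by (intro J.integrable_const_bound[where B=1])
      (auto intro!: AE_I2 simp: spJ measurable_cong_sets[OF setsJ refl])
  note transfer = partial_dp_transfer[OF M A f dp', where P=P, folded J_def]
  have fi[measurable]: "Measurable.pred ?L (\<lambda>\<pi>. i \<in> f\<^sub>L \<pi>)" for i
    by (rule measurable_compose[OF f]) simp
  \<comment> \<open>This weight switches index \<open>i\<close> off where it lies in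
    \<open>f\<^sub>L \<pi>\<close>, so that \<open>h\<close> meets the vanishing condition of the
    transfer lemma.\<close>
  define B1 where "B1 i = (\<lambda>\<pi>. indicator B \<pi> * of_bool (i \<notin> f\<^sub>L \<pi>) :: real)" for i
  have B1[measurable]: "B1 i \<in> borel_measurable ?L" for i
    unfolding B1_def by measurable
  define h where "h i x \<pi> = B1 i \<pi> * g i x \<pi>" for i x \<pi>
  have h[measurable]: "h i x \<in> borel_measurable ?L" for i x
    unfolding h_def by measurable
  have h01: "h i x \<pi> \<in> {0..1}" if "\<pi> \<in> space ?L" for i x \<pi>
    using g01[OF that, of i x] by (auto simp: h_def B1_def split: split_indicator)
  have mean: "(\<lambda>z. \<integral>x. F x (snd z) \<partial>P) \<in> borel_measurable (count_space UNIV \<Otimes>\<^sub>M ?L)"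
    if "\<And>x. F x \<in> borel_measurable ?L" for F :: "'x \<Rightarrow> _ \<Rightarrow> real"
    by (rule measurable_compose[OF measurable_snd measure_pmf.borel_measurable_lebesgue_integral])
       (rule measurable_pair_measure_pmf, rule that)
  have mean01: "(\<integral>x. F x \<partial>P) \<in> {0..1}" if "\<And>x. F x \<in> {0..1}" for F :: "'x \<Rightarrow> real"
    using that by (auto intro!: integral_nonneg measure_pmf.integral_le_const measure_pmf.integrable_const_bound[where B=1])
  have at: "(\<lambda>z. F (fst z i) (snd z)) \<in> borel_measurable (count_space UNIV \<Otimes>\<^sub>M ?L)"
    if "\<And>x. F x \<in> borel_measurable ?L" for F :: "'x \<Rightarrow> _ \<Rightarrow> real" and i :: 'm
    using that by (intro measurable_pair_measure_countable1) auto
  let ?pB = "measure J {z \<in> space J. snd z \<in> B}"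
  have Bm: "{z \<in> space J. snd z \<in> B} \<in> sets J"
    unfolding setsJ sets_eq_imp_space_eq[OF setsJ] by measurable
  have indB: "(\<integral>z. indicator B (snd z) \<partial>J) = ?pB"
  proof -
    have "(\<integral>z. indicator B (snd z) \<partial>J) = (\<integral>z. indicator {z \<in> space J. snd z \<in> B} z \<partial>J :: real)"
      by (intro Bochner_Integration.integral_cong) (auto split: split_indicator)
    then show ?thesis using Bm by simp
  qed
  have int_indB: "integrable J (\<lambda>z. indicator B (snd z) :: real)"
    by (rule intJ) (auto split: split_indicator)
  define r where "r i = (\<integral>z. (\<integral>x. h i x (snd z) \<partial>P) \<partial>J)" for i
  have int_h1: "integrable J (\<lambda>z. h i (fst z i) (snd z))" for i
    using h01 by (intro intJ at) auto
  have mean_h: "(\<integral>x. h i x \<pi> \<partial>P) \<in> {0..1}" if "\<pi> \<in> space ?L" for i \<pi>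
    using mean01[OF h01[OF that]] .
  have mean_g: "(\<integral>x. g i x \<pi> \<partial>P) \<in> {0..1}" if "\<pi> \<in> space ?L" for i \<pi>
    using mean01[OF g01[OF that]] .
  have int_h2: "integrable J (\<lambda>z. \<integral>x. h i x (snd z) \<partial>P)" for i
    using mean_h by (intro intJ mean) auto
  have r: "0 \<le> r i" "r i \<le> ?pB" for i
  proof -
    show "0 \<le> r i"
      unfolding r_def by (rule Bochner_Integration.integral_nonneg) (use mean_h in \<open>auto simp: spJ\<close>)
    have "(\<integral>x. h i x \<pi> \<partial>P) \<le> indicator B \<pi>" if "\<pi> \<in> space ?L" for \<pi>
      using mean_h[OF that, of i] by (auto simp: h_def B1_def split: split_indicator)
    then have "r i \<le> (\<integral>z. indicator B (snd z) \<partial>J)"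
      unfolding r_def by (intro integral_mono int_h2 int_indB) (auto simp: spJ)
    then show "r i \<le> ?pB" by (simp add: indB)
  qed
  have gap: "(\<integral>z. h i (fst z i) (snd z) - (\<integral>x. h i x (snd z) \<partial>P) \<partial>J) \<le> max (exp \<epsilon> - 1) 0 * ?pB + \<delta>" for i
  proof -
    have "(\<integral>z. h i (fst z i) (snd z) \<partial>J) \<le> exp \<epsilon> * r i + \<delta>"
      unfolding r_def by (rule transfer[OF _ _ _ h h01]) (auto simp: h_def B1_def)
    \<comment> \<open>For \<open>r i\<close> only an upper bound by the probability of
      \<open>B\<close> is available, so its factor must be made nonnegative before that bound is
      used.\<close>
    moreover have "(exp \<epsilon> - 1) * r i \<le> max (exp \<epsilon> - 1) 0 * r i"
      by (rule mult_right_mono) (use r in auto)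
    moreover have "max (exp \<epsilon> - 1) 0 * r i \<le> max (exp \<epsilon> - 1) 0 * ?pB"
      by (rule mult_left_mono) (use r in auto)
    ultimately show ?thesis
      using int_h1 int_h2 by (simp add: r_def[symmetric] algebra_simps)
  qed
  let ?G = "\<lambda>z. indicator B (snd z) *
      ((\<Sum>i\<in>UNIV. g i (fst z i) (snd z)) / CARD('m) - (\<Sum>i\<in>UNIV. \<integral>x. g i x (snd z) \<partial>P) / CARD('m))"
  let ?H = "\<lambda>z. (\<Sum>i\<in>UNIV. h i (fst z i) (snd z) - (\<integral>x. h i x (snd z) \<partial>P)) / CARD('m)
      + real \<kappa> / CARD('m) * indicator B (snd z)"
  have pw: "?G (S, \<pi>) \<le> ?H (S, \<pi>)" if \<pi>: "\<pi> \<in> space ?L" for S \<pi>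
  proof (cases "\<pi> \<in> B")
    case True
    have "(\<Sum>i\<in>UNIV. g i (S i) \<pi> - (\<integral>x. g i x \<pi> \<partial>P))
        \<le> (\<Sum>i\<in>UNIV. h i (S i) \<pi> - (\<integral>x. h i x \<pi> \<partial>P) + of_bool (i \<in> f\<^sub>L \<pi>))"
    proof (rule sum_mono)
      fix i
      \<comment> \<open>For \<open>i\<close> in \<open>f\<^sub>L \<pi>\<close> the terms in
        \<open>h\<close> vanish, and a difference of two numbers in the unit interval is at most
        1.\<close>
      show "g i (S i) \<pi> - (\<integral>x. g i x \<pi> \<partial>P) \<le> h i (S i) \<pi> - (\<integral>x. h i x \<pi> \<partial>P) + of_bool (i \<in> f\<^sub>L \<pi>)"
        using True mean_g[OF \<pi>, of i] g01[OF \<pi>, of i "S i"]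
        by (cases "i \<in> f\<^sub>L \<pi>") (auto simp: h_def B1_def)
    qed
    also have "\<dots> = (\<Sum>i\<in>UNIV. h i (S i) \<pi> - (\<integral>x. h i x \<pi> \<partial>P)) + card (f\<^sub>L \<pi>)"
      by (simp add: sum.distrib)
    also have "\<dots> \<le> (\<Sum>i\<in>UNIV. h i (S i) \<pi> - (\<integral>x. h i x \<pi> \<partial>P)) + \<kappa>"
      using card[OF \<pi>] by simp
    finally have "(\<Sum>i\<in>UNIV. g i (S i) \<pi> - (\<integral>x. g i x \<pi> \<partial>P)) / CARD('m) \<le>
        ((\<Sum>i\<in>UNIV. h i (S i) \<pi> - (\<integral>x. h i x \<pi> \<partial>P)) + \<kappa>) / CARD('m)"
      by (rule divide_right_mono) simp
    then show ?thesis
      using True by (simp add: sum_subtractf add_divide_distrib diff_divide_distrib)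
  next
    case False
    then show ?thesis by (simp add: h_def B1_def)
  qed
  show int_G: ?integrable
  proof (rule intJ)
    show "?G \<in> borel_measurable (count_space UNIV \<Otimes>\<^sub>M ?L)"
      by (intro borel_measurable_times borel_measurable_diff borel_measurable_divide borel_measurable_sum
          borel_measurable_const at mean g measurable_compose[OF measurable_snd borel_measurable_indicator[OF B]])
    fix z :: "('m \<Rightarrow> 'x) \<times> ('m, 'x) transcript" assume z: "snd z \<in> space ?L"
    have avg: "(\<Sum>i\<in>UNIV. F i) / CARD('m) \<in> {0..1}" if "\<And>i. F i \<in> {0..1}" for F :: "'m \<Rightarrow> real"
      using sum_bounded_above[of UNIV F 1] that by (auto simp: sum_nonneg divide_le_eq)
    have "(\<Sum>i\<in>UNIV. g i (fst z i) (snd z)) / CARD('m) \<in> {0..1}"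
      by (rule avg) (rule g01[OF z])
    moreover have "(\<Sum>i\<in>UNIV. \<integral>x. g i x (snd z) \<partial>P) / CARD('m) \<in> {0..1}"
      by (rule avg) (rule mean_g[OF z])
    ultimately have "\<bar>(\<Sum>i\<in>UNIV. g i (fst z i) (snd z)) / CARD('m)
        - (\<Sum>i\<in>UNIV. \<integral>x. g i x (snd z) \<partial>P) / CARD('m)\<bar> \<le> 1"
      unfolding atLeastAtMost_iff by linarith
    then show "\<bar>?G z\<bar> \<le> 1"
      by (cases "snd z \<in> B") simp_all
  qed
  have "(\<integral>z. ?G z \<partial>J) \<le> (\<integral>z. ?H z \<partial>J)"
  proof (rule integral_mono[OF int_G])
    show "integrable J ?H"
      by (intro Bochner_Integration.integrable_add Bochner_Integration.integrable_sum integrable_divide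
          integrable_mult_right Bochner_Integration.integrable_diff int_h1 int_h2 int_indB)
  qed (use pw in \<open>auto simp: spJ\<close>)
  also have "\<dots> = (\<Sum>i\<in>UNIV. (\<integral>z. h i (fst z i) (snd z) - (\<integral>x. h i x (snd z) \<partial>P) \<partial>J)) / CARD('m)
      + real \<kappa> / CARD('m) * ?pB"
    using int_h1 int_h2 int_indB by (simp add: Bochner_Integration.integral_sum indB)
  also have "\<dots> \<le> (\<Sum>i\<in>(UNIV :: 'm set). max (exp \<epsilon> - 1) 0 * ?pB + \<delta>) / CARD('m) + real \<kappa> / CARD('m) * ?pB"
    by (intro add_right_mono divide_right_mono sum_mono gap) simp
  also have "\<dots> = (max (exp \<epsilon> - 1) 0 + real \<kappa> / CARD('m)) * ?pB + \<delta>"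
    by (simp add: distrib_right)
  finally show ?gap .
qed

section \<open>Constraints that privacy puts on its parameters\<close>

text \<open>The empty event avoids every index and has probability 0 on both sides.\<close>

lemma partial_dp_delta_nonneg:
  fixes M :: "('m::finite, 'x::countable) mechanism" and A :: "('m, 'x) adversary"
  assumes "partial_dp k M \<epsilon> \<delta> \<kappa>" and "adversary k A"
  shows "0 \<le> \<delta>"
proof -
  obtain f\<^sub>L where "\<And>i S S' E. (\<forall>j. j \<noteq> i \<longrightarrow> S j = S' j) \<Longrightarrow> E \<in> sets (transcript_space k) \<Longrightarrow>
      i \<notin> (\<Union>\<pi>\<in>E. f\<^sub>L \<pi>) \<Longrightarrow>
      measure (interaction M A S k) E \<le> exp \<epsilon> * measure (interaction M A S' k) E + \<delta>"
    using assms unfolding partial_dp_def by metis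
  from this[of _ _ _ "{}"] show ?thesis by auto
qed

text \<open>Comparing a law with itself, privacy gives \<open>(1 - exp \<epsilon>) * Pr (i \<notin>
  f\<^sub>L \<Pi>) \<le> \<delta>\<close>, and these probabilities average to at least
  \<open>1 - \<kappa> / m\<close> over \<open>i\<close>. For negative \<open>\<epsilon>\<close> this
  compensates for the negative term \<open>exp \<epsilon> - 1\<close> in the error bound.\<close>

lemma partial_dp_nonpos_epsilon:
  fixes M :: "('m::finite, 'x::countable) mechanism" and A :: "('m, 'x) adversary"
  assumes M: "mechanism k M" and A: "adversary k A" and dp: "partial_dp k M \<epsilon> \<delta> \<kappa>"
    and "\<epsilon> \<le> 0"
  shows "(1 - exp \<epsilon>) * (1 - real \<kappa> / CARD('m)) \<le> \<delta>"
proof -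
  let ?L = "transcript_space k :: ('m, 'x) transcript measure"
  obtain f\<^sub>L where f: "f\<^sub>L \<in> ?L \<rightarrow>\<^sub>M count_space UNIV"
    and card: "\<And>\<pi>. \<pi> \<in> space ?L \<Longrightarrow> card (f\<^sub>L \<pi>) \<le> \<kappa>"
    and dp': "\<And>i S S' E. (\<forall>j. j \<noteq> i \<longrightarrow> S j = S' j) \<Longrightarrow> E \<in> sets ?L \<Longrightarrow> i \<notin> (\<Union>\<pi>\<in>E. f\<^sub>L \<pi>) \<Longrightarrow>
           measure (interaction M A S k) E \<le> exp \<epsilon> * measure (interaction M A S' k) E + \<delta>"
    using dp A unfolding partial_dp_def by metis
  fix S :: "'m \<Rightarrow> 'x"
  let ?I = "interaction M A S k"
  interpret I: prob_space ?I
    using interaction_in_prob_algebra[OF M A order_refl] by (auto simp: space_prob_algebra)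
  have sets: "sets ?I = sets ?L"
    using interaction_in_prob_algebra[OF M A order_refl] by (auto simp: space_prob_algebra)
  have sp: "space ?I = space ?L"
    by (rule sets_eq_imp_space_eq[OF sets])
  let ?E = "\<lambda>i. {\<pi> \<in> space ?L. i \<notin> f\<^sub>L \<pi>}"
  have E: "?E i \<in> sets ?L" for i
    using measurable_compose[OF f, of "\<lambda>X. i \<notin> X" "count_space UNIV"] by simp
  have le: "(1 - exp \<epsilon>) * measure ?I (?E i) \<le> \<delta>" for i
    using dp'[of i S S "?E i"] E by (auto simp: algebra_simps)
  \<comment> \<open>Every transcript leaves at least \<open>m - \<kappa>\<close> indices outside
    \<open>f\<^sub>L \<pi>\<close>; the expected number of them is the sum of the probabilities of
    the events \<open>?E i\<close>.\<close>
  have "CARD('m) - real \<kappa> = (\<integral>\<pi>. CARD('m) - real \<kappa> \<partial>?I)"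
    by (simp add: I.prob_space)
  also have "\<dots> \<le> (\<integral>\<pi>. (\<Sum>i\<in>UNIV. indicator (?E i) \<pi>) \<partial>?I)"
  proof (rule integral_mono)
    show "integrable ?I (\<lambda>\<pi>. \<Sum>i\<in>UNIV. indicator (?E i) \<pi> :: real)"
      using E sets by (intro Bochner_Integration.integrable_sum integrable_real_indicator) (auto simp: I.emeasure_eq_measure)
    fix \<pi> assume \<pi>: "\<pi> \<in> space ?I"
    have "(\<Sum>i\<in>UNIV. indicator (?E i) \<pi>) = (\<Sum>i\<in>UNIV. 1 - of_bool (i \<in> f\<^sub>L \<pi>) :: real)"
      using \<pi> sp by (intro sum.cong) auto
    also have "\<dots> = CARD('m) - real (card (f\<^sub>L \<pi>))"
      by (simp add: sum_subtractf)
    finally show "CARD('m) - real \<kappa> \<le> (\<Sum>i\<in>UNIV. indicator (?E i) \<pi>)"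
      using card[of \<pi>] \<pi> sp by simp
  qed simp
  also have "\<dots> = (\<Sum>i\<in>UNIV. measure ?I (?E i))"
    using E sets by (subst Bochner_Integration.integral_sum) (auto simp: I.emeasure_eq_measure)
  finally have "(1 - exp \<epsilon>) * (CARD('m) - real \<kappa>) \<le> (1 - exp \<epsilon>) * (\<Sum>i\<in>UNIV. measure ?I (?E i))"
    using \<open>\<epsilon> \<le> 0\<close> by (intro mult_left_mono) auto
  also have "\<dots> \<le> CARD('m) * \<delta>"
    unfolding sum_distrib_left using sum_bounded_above[of "UNIV :: 'm set" "\<lambda>i. (1 - exp \<epsilon>) * measure ?I (?E i)" \<delta>] le by simp
  finally show ?thesis
    by (simp add: field_simps)
qed

section \<open>Sample values, population values and errors\<close>

lemma query_value_bounds: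
  assumes "q \<in> space query_space"
  shows "query_value q S \<in> {0..1}"
  using query_space_bounds[OF assms] sum_bounded_above[of UNIV "\<lambda>i. q i (S i)" 1]
  by (auto simp: query_value_def sum_nonneg divide_le_eq)

lemma measurable_query_value [measurable]: "(\<lambda>q. query_value q S) \<in> borel_measurable query_space"
  unfolding query_value_def by measurable

lemma measurable_population_value [measurable]: "(\<lambda>q. population_value q P) \<in> borel_measurable query_space"
  unfolding population_value_def
  by (intro measure_pmf.borel_measurable_lebesgue_integral measurable_pair_measure_pmf) measurable

lemma integrable_query:
  assumes "q \<in> space query_space"
  shows "integrable (measure_pmf P) (q i)"
  using query_space_bounds[OF assms] by (intro measure_pmf.integrable_const_bound[where B=1]) auto

text \<open>Linearity of expectation, every coordinate of the sample having marginal law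
  \<open>P\<close>.\<close>

lemma population_value_eq:
  fixes q :: "('m::finite, 'x::countable) query"
  assumes "q \<in> space query_space"
  shows "population_value q P = (\<Sum>i\<in>UNIV. \<integral>x. q i x \<partial>P) / CARD('m)"
proof -
  have marginal: "map_pmf (\<lambda>S. S i) (iid_sample P) = P" for i :: 'm
    unfolding iid_sample_def by (simp add: Pi_pmf_component)
  have "integrable (iid_sample P) (\<lambda>S. q i (S i))" for i
    using query_space_bounds[OF assms] by (intro measure_pmf.integrable_const_bound[where B=1]) auto
  then have "population_value q P = (\<Sum>i\<in>UNIV. \<integral>S. q i (S i) \<partial>iid_sample P) / CARD('m)"
    unfolding population_value_def query_value_def by (simp add: Bochner_Integration.integral_sum)
  moreover have "(\<integral>S. q i (S i) \<partial>iid_sample P) = (\<integral>x. q i x \<partial>P)" for i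
    using integral_map_pmf[of "\<lambda>S. S i" "iid_sample P" "q i"] by (simp add: marginal)
  ultimately show ?thesis by simp
qed

lemma population_value_bounds:
  assumes "q \<in> space query_space"
  shows "population_value q P \<in> {0..1}"
  unfolding population_value_def using query_value_bounds[OF assms]
  by (auto intro!: integral_nonneg measure_pmf.integral_le_const measure_pmf.integrable_const_bound[where B=1])

lemma transcript_query_in_space:
  "\<pi> \<in> space (transcript_space k) \<Longrightarrow> t < k \<Longrightarrow> fst (\<pi> t) \<in> space query_space"
  by (auto simp: transcript_space_def space_PiM PiE_iff space_pair_measure mem_Times_iff)

lemma population_error_gt_iff:
  "0 < k \<Longrightarrow> T < population_error k \<pi> P \<longleftrightarrow>
    (\<exists>t<k. T < \<bar>snd (\<pi> t) - population_value (fst (\<pi> t)) P\<bar>)"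
  unfolding population_error_def by (subst Max_gr_iff) auto

lemma sample_error_ge_iff:
  "0 < k \<Longrightarrow> \<alpha> \<le> sample_error k \<pi> S \<longleftrightarrow>
    (\<exists>t<k. \<alpha> \<le> \<bar>snd (\<pi> t) - query_value (fst (\<pi> t)) S\<bar>)"
  unfolding sample_error_def by (subst Max_ge_iff) auto

text \<open>The maximum runs over finitely many rounds, and there are only countably many datasets,
  so each round need only be measurable in the transcript for a fixed dataset.\<close>

lemma sets_sample_error_ge:
  assumes "0 < k"
  shows "{(S, \<pi>) \<in> space (count_space UNIV \<Otimes>\<^sub>M transcript_space k). \<alpha> \<le> sample_error k \<pi> S}
    \<in> sets (count_space UNIV \<Otimes>\<^sub>M (transcript_space k :: ('m::finite, 'x::countable) transcript measure))"
proof -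
  have "Measurable.pred (count_space UNIV \<Otimes>\<^sub>M (transcript_space k :: ('m, 'x) transcript measure))
      (\<lambda>z. \<alpha> \<le> \<bar>snd (snd z t) - query_value (fst (snd z t)) (fst z)\<bar>)" if [measurable]: "t < k" for t
    by (rule measurable_pair_measure_countable1) auto
  then have "{z \<in> space (count_space UNIV \<Otimes>\<^sub>M transcript_space k).
      \<exists>t\<in>{..<k}. \<alpha> \<le> \<bar>snd (snd z t) - query_value (fst (snd z t)) (fst z)\<bar>}
    \<in> sets (count_space UNIV \<Otimes>\<^sub>M (transcript_space k :: ('m, 'x) transcript measure))"
    by (intro sets.sets_Collect_finite_Ex) (auto simp: pred_def)
  also have "{z \<in> space (count_space UNIV \<Otimes>\<^sub>M (transcript_space k :: ('m, 'x) transcript measure)).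
      \<exists>t\<in>{..<k}. \<alpha> \<le> \<bar>snd (snd z t) - query_value (fst (snd z t)) (fst z)\<bar>} =
    {(S, \<pi>) \<in> space (count_space UNIV \<Otimes>\<^sub>M transcript_space k). \<alpha> \<le> sample_error k \<pi> S}"
    unfolding sample_error_ge_iff[OF assms] by (auto simp: case_prod_beta Bex_def)
  finally show ?thesis .
qed

section \<open>Tail bound for the population error\<close>

theorem theorem3:
  fixes M :: "('m::finite, 'x::countable) mechanism"
    and A :: "('m, 'x) adversary"
    and P :: "'x pmf"
    and k \<kappa> :: nat
    and \<epsilon> \<delta> \<alpha> \<beta> c d :: real
  assumes "0 < k"
    and "mechanism k M"
    and "adversary k A"
    and "partial_dp k M \<epsilon> \<delta> \<kappa>"
    and "sample_accurate k M A P \<alpha> \<beta>"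
    and "0 < c" and "c \<le> 1"
    and "0 < d"
  shows "measure (sample_interaction k M A P)
           {(S, \<pi>) \<in> space (sample_interaction k M A P).
              population_error k \<pi> P
                > \<alpha> + (exp \<epsilon> - 1) + 2 * real \<kappa> / real CARD('m) + c + 2 * d}
         \<le> \<delta> / d + \<beta> / c"
proof -
  let ?L = "transcript_space k :: ('m, 'x) transcript measure"
  define J where "J = sample_interaction k M A P"
  define gap where "gap = (exp \<epsilon> - 1) + 2 * real \<kappa> / real CARD('m) + c + 2 * d"
  interpret J: prob_space J
    unfolding J_def by (rule prob_space_sample_interaction[OF assms(2,3)])
  have setsJ: "sets J = sets (count_space UNIV \<Otimes>\<^sub>M ?L)"
    unfolding J_def by (rule prob_space_sample_interaction[OF assms(2,3)])
  note spJ' = sets_eq_imp_space_eq[OF setsJ]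
  have spJ: "space J = UNIV \<times> space ?L"
    unfolding spJ' by (simp add: space_pair_measure)
  define bad where "bad t \<pi> \<longleftrightarrow> t < k \<and> \<alpha> + gap < \<bar>snd (\<pi> t) - population_value (fst (\<pi> t)) P\<bar>"
    for t and \<pi> :: "('m, 'x) transcript"
  have bad[measurable]: "Measurable.pred ?L (bad t)" for t
    unfolding bad_def by (cases "t < k") auto
  define sel where "sel \<pi> = (LEAST t. bad t \<pi>)" for \<pi>
  have sel[measurable]: "sel \<in> ?L \<rightarrow>\<^sub>M count_space UNIV"
    unfolding sel_def by measurable
  have sel_bad: "bad (sel \<pi>) \<pi>" if "\<exists>t. bad t \<pi>" for \<pi>
    unfolding sel_def using that by (rule LeastI_ex)
  \<comment> \<open>Complementing a query whose answer does not exceed its population value reduces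
    both signs of the error to a sample value that is too large. Without a bad round
    \<open>sel \<pi>\<close> is unspecified and may lie beyond the transcript, hence the default 0
    for \<open>t \<ge> k\<close>.\<close>
  define g where "g i x \<pi> = (let t = sel \<pi>; q = fst (\<pi> t) in
      if t < k then if population_value q P < snd (\<pi> t) then q i x else 1 - q i x else 0)"
    for i x \<pi>
  have g[measurable]: "g i x \<in> borel_measurable ?L" for i x
  proof -
    have "(\<lambda>\<pi>. if t < k then if population_value (fst (\<pi> t)) P < snd (\<pi> t) then fst (\<pi> t) i x
        else 1 - fst (\<pi> t) i x else 0) \<in> borel_measurable ?L" for t
      by (cases "t < k") auto
    from measurable_compose_countable[OF this sel] show ?thesis
      unfolding g_def Let_def .
  qed
  have g01: "g i x \<pi> \<in> {0..1}" if "\<pi> \<in> space ?L" for i x \<pi>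
    using query_space_bounds[OF transcript_query_in_space[OF that], of "sel \<pi>" i x] by (auto simp: g_def Let_def)
  define p where "p \<pi> = (\<Sum>i\<in>UNIV. \<integral>x. g i x \<pi> \<partial>P) / CARD('m)" for \<pi>
  define v where "v S \<pi> = (\<Sum>i\<in>UNIV. g i (S i) \<pi>) / CARD('m)" for S \<pi>
  have p[measurable]: "p \<in> borel_measurable ?L"
    unfolding p_def
    by (intro borel_measurable_divide borel_measurable_sum measure_pmf.borel_measurable_lebesgue_integral
        measurable_pair_measure_pmf borel_measurable_const g)
  have pv: "p \<pi> = (if population_value (fst (\<pi> (sel \<pi>))) P < snd (\<pi> (sel \<pi>))
        then population_value (fst (\<pi> (sel \<pi>))) P else 1 - population_value (fst (\<pi> (sel \<pi>))) P)"
      "v S \<pi> = (if population_value (fst (\<pi> (sel \<pi>))) P < snd (\<pi> (sel \<pi>))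
        then query_value (fst (\<pi> (sel \<pi>))) S else 1 - query_value (fst (\<pi> (sel \<pi>))) S)"
    if "\<pi> \<in> space ?L" "sel \<pi> < k" for \<pi> S
  proof -
    let ?q = "fst (\<pi> (sel \<pi>))"
    have q: "?q \<in> space query_space"
      using that by (rule transcript_query_in_space)
    show "p \<pi> = (if population_value ?q P < snd (\<pi> (sel \<pi>)) then population_value ?q P else 1 - population_value ?q P)"
      using that integrable_query[OF q]
      by (simp add: p_def g_def population_value_eq[OF q] sum_subtractf diff_divide_distrib)
    show "v S \<pi> = (if population_value ?q P < snd (\<pi> (sel \<pi>)) then query_value ?q S else 1 - query_value ?q S)"
      using that by (simp add: v_def g_def query_value_def sum_subtractf diff_divide_distrib)
  qed

  define B where "B = {\<pi> \<in> space ?L. \<alpha> + gap < population_error k \<pi> P}"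
  have B_eq: "B = {\<pi> \<in> space ?L. \<exists>t. bad t \<pi>}"
    unfolding B_def bad_def using \<open>0 < k\<close> by (simp add: population_error_gt_iff)
  have B[measurable]: "B \<in> sets ?L"
    unfolding B_eq by measurable
  define H where "H = {(S, \<pi>) \<in> space J. \<alpha> \<le> sample_error k \<pi> S}"
  have H: "H \<in> sets J"
    unfolding H_def spJ' setsJ using \<open>0 < k\<close> by (rule sets_sample_error_ge)
  have sel_B: "\<pi> \<in> space ?L" "sel \<pi> < k" "\<alpha> + gap < \<bar>snd (\<pi> (sel \<pi>)) - population_value (fst (\<pi> (sel \<pi>))) P\<bar>"
    if "\<pi> \<in> B" for \<pi>
    using that sel_bad[of \<pi>] by (auto simp: B_eq bad_def)
  have in01: "p \<pi> \<in> {0..1}" "v S \<pi> \<in> {0..1}" if "\<pi> \<in> B" for S \<pi>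
    using population_value_bounds[OF transcript_query_in_space[OF sel_B(1,2)[OF that]], of P]
      query_value_bounds[OF transcript_query_in_space[OF sel_B(1,2)[OF that]], of S]
    by (auto simp: pv[OF sel_B(1,2)[OF that]])
  \<comment> \<open>Off \<open>H\<close> the answer is within \<open>\<alpha>\<close> of the sample
    value, yet more than \<open>\<alpha> + gap\<close> from the population value, on the side fixed
    by the complementation.\<close>
  have excess: "gap < v S \<pi> - p \<pi>" if "\<pi> \<in> B" "(S, \<pi>) \<notin> H" for S \<pi>
  proof -
    have "\<bar>snd (\<pi> (sel \<pi>)) - query_value (fst (\<pi> (sel \<pi>))) S\<bar> < \<alpha>"
      using that(2) sel_B[OF that(1)] sample_error_ge_iff[OF \<open>0 < k\<close>, of \<alpha> \<pi> S] by (force simp: H_def spJ)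
    then show ?thesis
      using sel_B[OF that(1)] by (auto simp: pv abs_real_def split: if_splits)
  qed

  define B1 where "B1 = {\<pi> \<in> B. p \<pi> + gap \<le> 1}"
  have B1[measurable]: "B1 \<in> sets ?L"
  proof -
    have "B1 = B \<inter> {\<pi> \<in> space ?L. p \<pi> + gap \<le> 1}"
      using sets.sets_into_space[OF B] by (auto simp: B1_def)
    then show ?thesis by simp
  qed
  let ?E1 = "{z \<in> space J. snd z \<in> B1}" and ?E2 = "{z \<in> space J. snd z \<in> B - B1}"
  have "{z \<in> space J. snd z \<in> X} \<in> sets J" if "X \<in> sets ?L" for X
    using measurable_sets[OF measurable_snd[of "count_space UNIV"] that]
    unfolding setsJ spJ' by (simp add: vimage_def Int_def conj_commute)
  then have E: "?E1 \<in> sets J" "?E2 \<in> sets J"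
    using B B1 by blast+
  have "gap * measure J ?E1 - measure J (?E1 \<inter> H) =
      (\<integral>z. gap * indicator ?E1 z - indicator (?E1 \<inter> H) z \<partial>J)"
    using E H by (simp add: J.emeasure_eq_measure)
  also have "\<dots> \<le> (\<integral>z. indicator B1 (snd z) * (v (fst z) (snd z) - p (snd z)) \<partial>J)"
  proof (rule integral_mono)
    show "integrable J (\<lambda>z. gap * indicator ?E1 z - indicator (?E1 \<inter> H) z)"
      using E H by (simp add: J.emeasure_eq_measure)
    show "integrable J (\<lambda>z. indicator B1 (snd z) * (v (fst z) (snd z) - p (snd z)))"
      unfolding v_def p_def J_def by (rule partial_dp_selected_gap[OF assms(2-4) g g01 B1])
    fix z assume z: "z \<in> space J"
    obtain S \<pi> where S: "z = (S, \<pi>)" by fastforce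
    show "gap * indicator ?E1 z - indicator (?E1 \<inter> H) z \<le> indicator B1 (snd z) * (v (fst z) (snd z) - p (snd z))"
    proof (cases "\<pi> \<in> B1")
      case True
      then have "\<pi> \<in> B" "p \<pi> + gap \<le> 1"
        by (auto simp: B1_def)
      \<comment> \<open>Off \<open>H\<close> this is \<open>excess\<close>; on \<open>H\<close>,
        \<open>v S \<pi> \<ge> 0\<close> and \<open>p \<pi> \<le> 1 - gap\<close> give an excess of
        at least \<open>gap - 1\<close>.\<close>
      then show ?thesis
        using z True excess[of \<pi> S] in01(1)[of \<pi>] in01(2)[of \<pi> S] unfolding S by (cases "(S, \<pi>) \<in> H") auto
    qed (auto simp: S)
  qed
  also have "\<dots> \<le> (max (exp \<epsilon> - 1) 0 + \<kappa> / CARD('m)) * measure J ?E1 + \<delta>"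
    unfolding v_def p_def J_def by (rule partial_dp_selected_gap[OF assms(2-4) g g01 B1])
  finally have E1: "(gap - max (exp \<epsilon> - 1) 0 - \<kappa> / CARD('m)) * measure J ?E1 \<le> \<delta> + measure J (?E1 \<inter> H)"
    by (simp add: algebra_simps)

  have "?E2 \<subseteq> H"
  proof
    fix z assume z: "z \<in> ?E2"
    obtain S \<pi> where S: "z = (S, \<pi>)" by fastforce
    with z have \<pi>: "\<pi> \<in> B" "1 < p \<pi> + gap"
      by (auto simp: B1_def)
    then have "\<not> gap < v S \<pi> - p \<pi>"
      using in01(2)[of \<pi> S] by auto
    then show "z \<in> H"
      using excess[OF \<pi>(1), of S] S by blast
  qed
  then have E2: "measure J ?E2 \<le> measure J (?E2 \<inter> H)"
    by (simp add: Int_absorb2)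
  have "measure J H \<le> \<beta>"
    using assms(5) unfolding sample_accurate_def H_def J_def .
  moreover have "measure J (?E1 \<inter> H) + measure J (?E2 \<inter> H) \<le> measure J H"
    using E H by (subst J.finite_measure_Union[symmetric]) (auto intro!: J.finite_measure_mono)
  ultimately have \<beta>: "measure J (?E1 \<inter> H) + measure J (?E2 \<inter> H) \<le> \<beta>"
    by simp
  have meas_B: "measure J {(S, \<pi>) \<in> space J. \<alpha> + gap < population_error k \<pi> P} = measure J ?E1 + measure J ?E2"
  proof -
    have "{(S, \<pi>) \<in> space J. \<alpha> + gap < population_error k \<pi> P} = ?E1 \<union> ?E2"
      by (auto simp: B1_def B_def spJ)
    then show ?thesis
      using E by (simp only:) (subst J.finite_measure_Union, auto)
  qed
  have \<delta>: "0 \<le> \<delta>"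
    using assms(3,4) by (rule partial_dp_delta_nonneg[rotated])
  have "measure J {(S, \<pi>) \<in> space J. \<alpha> + gap < population_error k \<pi> P} \<le> \<delta> / d + \<beta> / c"
  \<comment> \<open>If \<open>d \<le> \<delta>\<close>, the right-hand side is at least 1.\<close>
  proof (cases "d \<le> \<delta>")
    case True
    have "0 \<le> \<beta>"
      using \<beta> measure_nonneg[of J "?E1 \<inter> H"] measure_nonneg[of J "?E2 \<inter> H"] by linarith
    then have "1 \<le> \<delta> / d" "0 \<le> \<beta> / c"
      using True \<open>0 < d\<close> \<open>0 < c\<close> by auto
    then show ?thesis
      using J.prob_le_1[of "{(S, \<pi>) \<in> space J. \<alpha> + gap < population_error k \<pi> P}"] by linarith
  next
    case False
    have "c + d \<le> gap - max (exp \<epsilon> - 1) 0 - \<kappa> / CARD('m)"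
    proof (cases "0 \<le> \<epsilon>")
      case True
      have "0 \<le> \<kappa> / CARD('m)" by simp
      with True \<open>0 < d\<close> show ?thesis by (simp add: gap_def)
    next
      case neg: False
      \<comment> \<open>With the maximum equal to 0, the claim reduces to
        \<open>1 - exp \<epsilon> - \<kappa> / m \<le> d\<close>: the second
        \<open>\<kappa> / m\<close> and the second \<open>d\<close> in \<open>gap\<close> pay for
        the negative \<open>exp \<epsilon> - 1\<close>, because \<open>\<delta> < d\<close>.\<close>
      have "(1 - exp \<epsilon>) * (1 - \<kappa> / CARD('m)) \<le> \<delta>"
        using neg by (intro partial_dp_nonpos_epsilon[OF assms(2-4)]) simp
      moreover have "(1 - exp \<epsilon>) * (\<kappa> / CARD('m)) \<le> \<kappa> / CARD('m)"
        by (rule mult_left_le_one_le) (use neg in auto)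
      ultimately have "1 - exp \<epsilon> - \<kappa> / CARD('m) \<le> \<delta>"
        by (simp add: algebra_simps)
      with neg False show ?thesis by (simp add: gap_def)
    qed
    then have "(c + d) * measure J ?E1 \<le> \<delta> + measure J (?E1 \<inter> H)"
      using E1 by (meson measure_nonneg mult_right_mono order_trans)
    then have "measure J ?E1 \<le> (\<delta> + measure J (?E1 \<inter> H)) / (c + d)"
      using \<open>0 < c\<close> \<open>0 < d\<close> by (simp add: field_simps)
    \<comment> \<open>Both numerators are nonnegative, so \<open>c + d\<close> may be lowered to
      \<open>d\<close> under \<open>\<delta>\<close> and to \<open>c\<close> under the sample-error
      probability.\<close>
    also have "\<dots> \<le> \<delta> / d + measure J (?E1 \<inter> H) / c"
      unfolding add_divide_distrib using \<open>0 < c\<close> \<open>0 < d\<close> \<delta> by (intro add_mono divide_left_mono) auto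
    finally have "measure J ?E1 \<le> \<delta> / d + measure J (?E1 \<inter> H) / c" .
    \<comment> \<open>Dividing by \<open>c \<le> 1\<close> does not decrease the right-hand side;
      both parts of the bad event then share the single budget \<open>\<beta> / c\<close>.\<close>
    moreover have "measure J ?E2 \<le> measure J (?E2 \<inter> H) / c"
      by (rule order_trans[OF E2]) (use \<open>0 < c\<close> \<open>c \<le> 1\<close> in \<open>simp add: pos_le_divide_eq mult_left_le\<close>)
    moreover have "measure J (?E1 \<inter> H) / c + measure J (?E2 \<inter> H) / c \<le> \<beta> / c"
      using \<beta> \<open>0 < c\<close> by (simp add: divide_right_mono flip: add_divide_distrib)
    ultimately show ?thesis
      unfolding meas_B by linarith
  qed
  then show ?thesis
    by (simp add: J_def gap_def add.assoc)
qed

end
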